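(* Let $(J,\mathcal{A})$ be a standard Borel space and let $\varphi,\psi$ be finite signed measures on $(J\times J,\mathcal{A}\times\mathcal{A})$. There exists a circulation $\alpha$ with $\varphi\le\alpha\le\psi$ if and only if $\varphi\le\psi$ and $\varphi(X\times X^c)\le\psi(X^c\times X)$ for every $X\in\mathcal{A}$ (where $X^c=J\setminus X$).
   Context: A circulation is a finite signed measure $\alpha$ on $\mathcal{A}\times\mathcal{A}$ whose two marginals agree: $\alpha(A\times J)=\alpha(J\times A)$ for all $A\in\mathcal{A}$. Inequalities between signed measures are setwise: $\mu\le\nu$ means $\mu(S)\le\nu(S)$ for every measurable $S$. *)

theory Defs
  imports "HOL-Analysis.Analysis"
begin

text \<open>
  A measurable space \<open>(J, \<A>)\<close> is represented by \<open>M :: 'a measure\<close> with \<open>J = space M\<close> and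
  \<open>\<A> = sets M\<close>; the measure that \<open>M\<close> carries plays no role below. Likewise, only the
  sigma-algebra of \<open>M \<Otimes>\<^sub>M M\<close> is used.
\<close>

text \<open>
  As in the class \<open>polish_space\<close>, a Polish topology is a second countable, completely
  metrizable one.
\<close>

definition standard_borel :: "'a measure \<Rightarrow> bool" where
  "standard_borel M \<longleftrightarrow>
    (\<exists>X. topspace X = space M \<and> completely_metrizable_space X \<and> second_countable X \<and>
         sets M = sigma_sets (topspace X) {U. openin X U})"

text \<open>
  Finiteness is built into the codomain \<^typ>\<open>real\<close>. Values outside \<^term>\<open>sets M\<close> are irrelevant.
  The relation \<open>sums\<close> requires convergence of the series, which \<open>suminf\<close> alone would not.
\<close>

definition finite_signed_measure :: "'a measure \<Rightarrow> ('a set \<Rightarrow> real) \<Rightarrow> bool" where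
  "finite_signed_measure M \<mu> \<longleftrightarrow>
    \<mu> {} = 0 \<and>
    (\<forall>A :: nat \<Rightarrow> 'a set. range A \<subseteq> sets M \<longrightarrow> disjoint_family A \<longrightarrow>
      (\<lambda>i. \<mu> (A i)) sums \<mu> (\<Union>i. A i))"

definition signed_measure_le :: "'a measure \<Rightarrow> ('a set \<Rightarrow> real) \<Rightarrow> ('a set \<Rightarrow> real) \<Rightarrow> bool" where
  "signed_measure_le M \<mu> \<nu> \<longleftrightarrow> (\<forall>S\<in>sets M. \<mu> S \<le> \<nu> S)"

definition circulation :: "'a measure \<Rightarrow> (('a \<times> 'a) set \<Rightarrow> real) \<Rightarrow> bool" where
  "circulation M \<alpha> \<longleftrightarrow>
    finite_signed_measure (M \<Otimes>\<^sub>M M) \<alpha> \<and>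
    (\<forall>A\<in>sets M. \<alpha> (A \<times> space M) = \<alpha> (space M \<times> A))"

end

theory Submission
  imports Defs
begin

text \<open>
  The additive set functions \<open>\<alpha>\<close> with \<open>\<phi> \<le> \<alpha> \<le> \<psi>\<close> form a compact set in the product topology, so
  the marginal conditions need only be met for finitely many \<open>A\<close> at a time, hence on the blocks
  of a finite partition \<open>P\<close> of \<open>J\<close>. There, minimise the sum of squares of the excesses
  \<open>e i = \<alpha> (P i \<times> J) - \<alpha> (J \<times> P i)\<close>. Perturbing a minimiser on a single rectangle \<open>P i \<times> P j\<close>
  shows \<open>\<alpha> = \<phi>\<close> on it if \<open>e i > e j\<close>, and \<open>\<alpha> = \<psi>\<close> on it if \<open>e i < e j\<close>. With \<open>X\<close> the union
  of the blocks of positive excess, the total excess of \<open>X\<close> is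
  \<open>\<phi> (X \<times> X\<^sup>c) - \<psi> (X\<^sup>c \<times> X) \<le> 0\<close>, so no block has positive excess; as the excesses add up
  to zero, they all vanish. Countable additivity comes for free, since \<open>\<alpha>\<close> is squeezed between
  two signed measures.
\<close>

text \<open>Fixing the junk values outside \<open>\<N>\<close> is what makes this set compact.\<close>

definition additive_between ::
  "'b set set \<Rightarrow> ('b set \<Rightarrow> real) \<Rightarrow> ('b set \<Rightarrow> real) \<Rightarrow> ('b set \<Rightarrow> real) set" where
  "additive_between \<N> \<phi> \<psi> =
    {\<alpha>. additive \<N> \<alpha> \<and> (\<forall>S\<in>\<N>. \<phi> S \<le> \<alpha> S \<and> \<alpha> S \<le> \<psi> S) \<and> (\<forall>S. S \<notin> \<N> \<longrightarrow> \<alpha> S = 0)}"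

lemma additive_betweenD:
  assumes "\<alpha> \<in> additive_between \<N> \<phi> \<psi>"
  shows "additive \<N> \<alpha>" "\<And>S. S \<in> \<N> \<Longrightarrow> \<phi> S \<le> \<alpha> S" "\<And>S. S \<in> \<N> \<Longrightarrow> \<alpha> S \<le> \<psi> S"
  using assms by (auto simp: additive_between_def)

section \<open>Finitely additive set functions\<close>

lemma finite_signed_measure_additive:
  assumes "finite_signed_measure N \<mu>"
  shows "additive (sets N) \<mu>"
  unfolding additive_def
proof (intro ballI impI)
  fix S T assume *: "S \<in> sets N" "T \<in> sets N" "S \<inter> T = {}"
  have "range (binaryset S T) \<subseteq> sets N"
    using * by (simp add: range_binaryset_eq)
  moreover have "disjoint_family (binaryset S T)"
    using * by (auto simp: disjoint_family_on_def binaryset_def)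
  ultimately have "(\<lambda>i. \<mu> (binaryset S T i)) sums \<mu> (S \<union> T)"
    using assms unfolding finite_signed_measure_def by (metis UN_binaryset_eq)
  moreover have "(\<lambda>i. \<mu> (binaryset S T i)) sums (\<mu> S + \<mu> T)"
    using assms by (intro binaryset_sums) (simp add: finite_signed_measure_def)
  ultimately show "\<mu> (S \<union> T) = \<mu> S + \<mu> T"
    by (rule sums_unique2)
qed

lemma additive_empty:
  fixes \<mu> :: "'b set \<Rightarrow> real"
  assumes "additive (sets N) \<mu>"
  shows "\<mu> {} = 0"
  using additiveD[OF assms, of "{}" "{}"] by simp

lemma additive_Int_Diff:
  fixes \<mu> :: "'b set \<Rightarrow> real"
  assumes "additive (sets N) \<mu>" "S \<in> sets N" "P \<in> sets N"
  shows "\<mu> S = \<mu> (S \<inter> P) + \<mu> (S - P)"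
proof -
  have "\<mu> ((S \<inter> P) \<union> (S - P)) = \<mu> (S \<inter> P) + \<mu> (S - P)"
    using assms by (intro additiveD[OF assms(1)]) auto
  then show ?thesis
    by (simp add: Int_Diff_Un)
qed

lemma additive_UN:
  fixes \<mu> :: "'b set \<Rightarrow> real"
  assumes "additive (sets N) \<mu>" "finite I" "\<And>i. i \<in> I \<Longrightarrow> A i \<in> sets N" "disjoint_family_on A I"
  shows "\<mu> (\<Union>i\<in>I. A i) = (\<Sum>i\<in>I. \<mu> (A i))"
  using assms(2-4)
proof (induction I rule: finite_induct)
  case empty
  then show ?case using additive_empty[OF assms(1)] by simp
next
  case (insert i I)
  have "A i \<inter> (\<Union>j\<in>I. A j) = {}"
    using insert.hyps insert.prems(2) by (auto simp: disjoint_family_on_def)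
  moreover have "(\<Union>j\<in>I. A j) \<in> sets N"
    using insert by auto
  ultimately have "\<mu> (A i \<union> (\<Union>j\<in>I. A j)) = \<mu> (A i) + \<mu> (\<Union>j\<in>I. A j)"
    using insert.prems by (intro additiveD[OF assms(1)]) auto
  moreover have "\<mu> (\<Union>j\<in>I. A j) = (\<Sum>j\<in>I. \<mu> (A j))"
    using insert by (auto simp: disjoint_family_on_def)
  ultimately show ?case
    using insert.hyps by simp
qed

section \<open>Compactness, countable additivity and perturbations between the two bounds\<close>

text \<open>By Tychonoff the product of the intervals \<open>{\<phi> S..\<psi> S}\<close> is
  compact, and each instance of additivity is an equation between three coordinates, hence a closed
  condition.\<close>

lemma compact_additive_between: "compact (additive_between \<N> \<phi> \<psi>)"
proof -
  let ?box = "PiE UNIV (\<lambda>S. if S \<in> \<N> then {\<phi> S..\<psi> S} else {0::real})"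
  have "compactin (product_topology (\<lambda>_. euclidean) UNIV) ?box"
    by (auto simp: compactin_PiE)
  then have "compact ?box"
    by (simp add: euclidean_product_topology)
  moreover have "closed {\<alpha> :: 'a set \<Rightarrow> real. additive \<N> \<alpha>}"
    unfolding additive_def Ball_def
    by (intro closed_Collect_all closed_Collect_imp closed_Collect_eq open_Collect_const
        continuous_intros continuous_on_product_coordinates)
  ultimately have "compact (?box \<inter> {\<alpha>. additive \<N> \<alpha>})"
    by (rule compact_Int_closed)
  also have "?box \<inter> {\<alpha>. additive \<N> \<alpha>} = additive_between \<N> \<phi> \<psi>"
    by (auto simp: additive_between_def PiE_iff split: if_splits)
  finally show ?thesis .
qed

text \<open>For a finitely additive function, countable additivity amounts to the values on the
  tails \<open>?R n\<close> tending to 0. The values of \<alpha> there are squeezed between those of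
  \<phi> and \<psi>, which do tend to 0.\<close>

lemma additive_between_finite_signed_measure:
  assumes \<phi>: "finite_signed_measure N \<phi>" and \<psi>: "finite_signed_measure N \<psi>"
    and \<alpha>: "\<alpha> \<in> additive_between (sets N) \<phi> \<psi>"
  shows "finite_signed_measure N \<alpha>"
  unfolding finite_signed_measure_def
proof (intro conjI allI impI)
  note add = additive_betweenD(1)[OF \<alpha>]
  show "\<alpha> {} = 0" by (rule additive_empty[OF add])
  fix A :: "nat \<Rightarrow> 'a set" assume A: "range A \<subseteq> sets N" "disjoint_family A"
  let ?U = "\<Union>i. A i"
  let ?R = "\<lambda>n. ?U - (\<Union>i<n. A i)"
  have tail: "\<mu> (?R n) = \<mu> ?U - (\<Sum>i<n. \<mu> (A i))" if "additive (sets N) \<mu>" for \<mu> :: "'a set \<Rightarrow> real" and n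
  proof -
    have "\<mu> ?U = \<mu> (?U \<inter> (\<Union>i<n. A i)) + \<mu> (?R n)"
      using A by (intro additive_Int_Diff[OF that]) auto
    also have "?U \<inter> (\<Union>i<n. A i) = (\<Union>i<n. A i)" by auto
    also have "\<mu> (\<Union>i<n. A i) = (\<Sum>i<n. \<mu> (A i))"
      using A by (intro additive_UN[OF that]) (auto simp: disjoint_family_on_def)
    finally show ?thesis by simp
  qed
  have lim: "(\<lambda>n. \<mu> (?R n)) \<longlonglongrightarrow> 0" if "finite_signed_measure N \<mu>" for \<mu>
  proof -
    have "(\<lambda>n. \<Sum>i<n. \<mu> (A i)) \<longlonglongrightarrow> \<mu> ?U"
      using that A unfolding finite_signed_measure_def sums_def by blast
    then have "(\<lambda>n. \<mu> ?U - (\<Sum>i<n. \<mu> (A i))) \<longlonglongrightarrow> \<mu> ?U - \<mu> ?U"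
      by (intro tendsto_intros)
    then show ?thesis
      by (simp add: tail[OF finite_signed_measure_additive[OF that]])
  qed
  have R: "?R n \<in> sets N" for n using A by auto
  have "(\<lambda>n. \<alpha> (?R n)) \<longlonglongrightarrow> 0"
    by (rule tendsto_sandwich[OF _ _ lim[OF \<phi>] lim[OF \<psi>]])
       (intro always_eventually allI additive_betweenD[OF \<alpha>] R)+
  then have "(\<lambda>n. \<alpha> ?U - \<alpha> (?R n)) \<longlonglongrightarrow> \<alpha> ?U - 0"
    by (intro tendsto_intros)
  then show "(\<lambda>i. \<alpha> (A i)) sums \<alpha> ?U"
    unfolding sums_def by (simp add: tail[OF add])
qed

text \<open>The new function moves \<alpha> a fraction \<open>s\<close> of the way towards \<beta>
  inside \<open>P\<close> and leaves it alone outside. Both bounds hold for the convex combination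
  on \<open>S \<inter> P\<close> and for \<alpha> on \<open>S - P\<close>, and they add up because
  \<phi> and \<psi> are additive.\<close>

lemma additive_between_perturb:
  assumes \<phi>: "additive (sets N) \<phi>" and \<psi>: "additive (sets N) \<psi>"
    and \<alpha>: "\<alpha> \<in> additive_between (sets N) \<phi> \<psi>" and \<beta>: "\<beta> \<in> additive_between (sets N) \<phi> \<psi>"
    and P: "P \<in> sets N" and s: "0 \<le> s" "s \<le> 1"
  shows "(\<lambda>S. if S \<in> sets N then \<alpha> S + s * (\<beta> (S \<inter> P) - \<alpha> (S \<inter> P)) else 0)
    \<in> additive_between (sets N) \<phi> \<psi>"
proof -
  note \<alpha>D = additive_betweenD[OF \<alpha>] and \<beta>D = additive_betweenD[OF \<beta>]
  have add: "\<mu> ((S \<union> T) \<inter> P) = \<mu> (S \<inter> P) + \<mu> (T \<inter> P)"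
    if "additive (sets N) \<mu>" "S \<in> sets N" "T \<in> sets N" "S \<inter> T = {}" for \<mu> :: "'a set \<Rightarrow> real" and S T
    unfolding Int_Un_distrib2 using that P by (intro additiveD[OF that(1)]) auto
  have "\<phi> S \<le> \<alpha> S + s * (\<beta> (S \<inter> P) - \<alpha> (S \<inter> P)) \<and> \<alpha> S + s * (\<beta> (S \<inter> P) - \<alpha> (S \<inter> P)) \<le> \<psi> S"
    if S: "S \<in> sets N" for S
  proof -
    have "S \<inter> P \<in> sets N" "S - P \<in> sets N" using S P by auto
    note bounds = this[THEN \<alpha>D(2)] this[THEN \<alpha>D(3)] this[THEN \<beta>D(2)] this[THEN \<beta>D(3)]
    have eq: "\<alpha> S + s * (\<beta> (S \<inter> P) - \<alpha> (S \<inter> P))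
        = \<alpha> (S - P) + ((1 - s) * \<alpha> (S \<inter> P) + s * \<beta> (S \<inter> P))"
      using additive_Int_Diff[OF \<alpha>D(1) S P] by (simp add: algebra_simps)
    have "(1 - s) * \<phi> (S \<inter> P) + s * \<phi> (S \<inter> P) \<le> (1 - s) * \<alpha> (S \<inter> P) + s * \<beta> (S \<inter> P)"
         "(1 - s) * \<alpha> (S \<inter> P) + s * \<beta> (S \<inter> P) \<le> (1 - s) * \<psi> (S \<inter> P) + s * \<psi> (S \<inter> P)"
      using s bounds by (auto intro!: add_mono mult_left_mono)
    then show ?thesis
      using bounds additive_Int_Diff[OF \<phi> S P] additive_Int_Diff[OF \<psi> S P]
      unfolding eq by (simp add: algebra_simps)
  qed
  moreover have "additive (sets N)
      (\<lambda>S. if S \<in> sets N then \<alpha> S + s * (\<beta> (S \<inter> P) - \<alpha> (S \<inter> P)) else 0)"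
    unfolding additive_def
    by (auto simp: add \<alpha>D(1) \<beta>D(1) additiveD[OF \<alpha>D(1)] algebra_simps)
  ultimately show ?thesis
    by (simp add: additive_between_def)
qed

lemma additive_between_restrict:
  assumes "additive (sets N) \<mu>" "\<And>S. S \<in> sets N \<Longrightarrow> \<phi> S \<le> \<mu> S \<and> \<mu> S \<le> \<psi> S"
  shows "(\<lambda>S. if S \<in> sets N then \<mu> S else 0) \<in> additive_between (sets N) \<phi> \<psi>"
  using assms by (auto simp: additive_between_def additive_def)

section \<open>Excess of a set\<close>

text \<open>With \<alpha> read as a flow, this is the net outflow of \<open>A\<close>; circulations
  are the finite signed measures whose excess vanishes on all measurable sets.\<close>

definition excess :: "'a measure \<Rightarrow> (('a \<times> 'a) set \<Rightarrow> real) \<Rightarrow> 'a set \<Rightarrow> real" where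
  "excess M \<alpha> A = \<alpha> (A \<times> space M) - \<alpha> (space M \<times> A)"

lemma excess_UN:
  assumes "additive (sets (M \<Otimes>\<^sub>M M)) \<alpha>" "finite I" "\<And>i. i \<in> I \<Longrightarrow> A i \<in> sets M"
    and "disjoint_family_on A I"
  shows "excess M \<alpha> (\<Union>i\<in>I. A i) = (\<Sum>i\<in>I. excess M \<alpha> (A i))"
proof -
  have "\<alpha> (\<Union>i\<in>I. A i \<times> space M) = (\<Sum>i\<in>I. \<alpha> (A i \<times> space M))"
    using assms by (intro additive_UN[OF assms(1)]) (auto simp: disjoint_family_on_def)
  moreover have "\<alpha> (\<Union>i\<in>I. space M \<times> A i) = (\<Sum>i\<in>I. \<alpha> (space M \<times> A i))"
    using assms by (intro additive_UN[OF assms(1)]) (auto simp: disjoint_family_on_def)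
  moreover have "(\<Union>i\<in>I. A i) \<times> space M = (\<Union>i\<in>I. A i \<times> space M)"
    "space M \<times> (\<Union>i\<in>I. A i) = (\<Union>i\<in>I. space M \<times> A i)" by auto
  ultimately show ?thesis
    by (simp add: excess_def sum_subtractf)
qed

text \<open>The part \<open>X \<times> X\<close> is counted in both marginals and cancels, so only
  the flow across the cut remains. This links the marginal condition to the cut condition in both
  directions of the theorem.\<close>

lemma excess_cut:
  assumes "additive (sets (M \<Otimes>\<^sub>M M)) \<alpha>" "X \<in> sets M"
  shows "excess M \<alpha> X = \<alpha> (X \<times> (space M - X)) - \<alpha> ((space M - X) \<times> X)"
proof -
  note X = sets.sets_into_space[OF assms(2)]
  have "\<alpha> (X \<times> space M) = \<alpha> (X \<times> space M \<inter> X \<times> X) + \<alpha> (X \<times> space M - X \<times> X)"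
    "\<alpha> (space M \<times> X) = \<alpha> (space M \<times> X \<inter> X \<times> X) + \<alpha> (space M \<times> X - X \<times> X)"
    using assms by (intro additive_Int_Diff[OF assms(1)]; auto)+
  moreover have "X \<times> space M \<inter> X \<times> X = X \<times> X" "X \<times> space M - X \<times> X = X \<times> (space M - X)"
    "space M \<times> X \<inter> X \<times> X = X \<times> X" "space M \<times> X - X \<times> X = (space M - X) \<times> X"
    using X by auto
  ultimately show ?thesis
    by (simp add: excess_def)
qed

section \<open>Minimising the squared excesses on a finite partition\<close>

text \<open>Divide by \<open>s\<close> and let \<open>s\<close> tend to 0 from the right. This
  extracts the first-order condition at a minimiser from one-sided perturbations.\<close>

lemma nonneg_linear_part:
  fixes c d :: real
  assumes "\<And>s. 0 \<le> s \<Longrightarrow> s \<le> 1 \<Longrightarrow> 0 \<le> s * c + s\<^sup>2 * d"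
  shows "0 \<le> c"
proof -
  have "0 \<le> c + s * d" if "s \<in> {0<..<1}" for s
  proof -
    have "0 \<le> s * (c + s * d)"
      using assms[of s] that by (simp add: algebra_simps power2_eq_square)
    then show ?thesis using that by (simp add: zero_le_mult_iff)
  qed
  then have "\<forall>\<^sub>F s in at_right 0. 0 \<le> c + s * d"
    by (auto simp: eventually_at_right_field intro!: exI[of _ 1])
  moreover have "((\<lambda>s. c + s * d) \<longlongrightarrow> c + 0 * d) (at_right 0)"
    by (intro tendsto_intros)
  ultimately show ?thesis
    using tendsto_lowerbound[of "\<lambda>s. c + s * d" c "at_right 0" 0] by simp
qed

text \<open>Adding mass \<open>t\<close> on a rectangle with row block \<open>i\<close> and column
  block \<open>j\<close> raises the excess of \<open>i\<close> and lowers that of \<open>j\<close>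
  by \<open>t\<close>; this is the resulting change of the objective.\<close>

lemma sum_power2_transfer:
  fixes e :: "'i \<Rightarrow> real"
  assumes "finite I" "i \<in> I" "j \<in> I" "i \<noteq> j"
  shows "(\<Sum>k\<in>I. (e k + (if k = i then t else 0) - (if k = j then t else 0))\<^sup>2)
    = (\<Sum>k\<in>I. (e k)\<^sup>2) + 2 * t * (e i - e j) + 2 * t\<^sup>2"
proof -
  have "(e k + (if k = i then t else 0) - (if k = j then t else 0))\<^sup>2
      = (e k)\<^sup>2 + (if k = i then 2 * t * e i + t\<^sup>2 else 0) + (if k = j then t\<^sup>2 - 2 * t * e j else 0)" for k
    using assms(4) by (auto simp: power2_eq_square algebra_simps)
  then show ?thesis
    using assms by (simp add: sum.distrib algebra_simps)
qed

lemma partition_excess_zero: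
  fixes M :: "'a measure" and P :: "'i \<Rightarrow> 'a set"
  defines "N \<equiv> M \<Otimes>\<^sub>M M"
  assumes \<phi>: "additive (sets N) \<phi>" and \<psi>: "additive (sets N) \<psi>"
    and le: "\<And>S. S \<in> sets N \<Longrightarrow> \<phi> S \<le> \<psi> S"
    and cut: "\<And>X. X \<in> sets M \<Longrightarrow> \<phi> (X \<times> (space M - X)) \<le> \<psi> ((space M - X) \<times> X)"
    and I: "finite I" and P: "\<And>i. i \<in> I \<Longrightarrow> P i \<in> sets M" "disjoint_family_on P I"
    and cover: "(\<Union>i\<in>I. P i) = space M"
  shows "\<exists>\<alpha>\<in>additive_between (sets N) \<phi> \<psi>. \<forall>i\<in>I. excess M \<alpha> (P i) = 0"
proof -
  let ?K = "additive_between (sets N) \<phi> \<psi>"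
  \<comment> \<open>The bounds themselves, set to 0 off \<open>sets N\<close> so that they belong to
    \<open>?K\<close>. They make \<open>?K\<close> nonempty and later serve as the targets \<beta>
    of the perturbation.\<close>
  let ?\<phi> = "\<lambda>S. if S \<in> sets N then \<phi> S else 0"
  let ?\<psi> = "\<lambda>S. if S \<in> sets N then \<psi> S else 0"
  have \<phi>K: "?\<phi> \<in> ?K" and \<psi>K: "?\<psi> \<in> ?K"
    using le by (auto intro!: additive_between_restrict \<phi> \<psi>)
  have "\<exists>\<alpha>\<in>?K. \<forall>\<alpha>'\<in>?K. (\<Sum>i\<in>I. (excess M \<alpha> (P i))\<^sup>2) \<le> (\<Sum>i\<in>I. (excess M \<alpha>' (P i))\<^sup>2)"
  proof (rule continuous_attains_inf[OF compact_additive_between])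
    show "?K \<noteq> {}" using \<phi>K by auto
    show "continuous_on ?K (\<lambda>\<alpha>. \<Sum>i\<in>I. (excess M \<alpha> (P i))\<^sup>2)"
      unfolding excess_def
      by (intro continuous_intros continuous_on_subset[OF continuous_on_product_coordinates]) auto
  qed
  then obtain \<alpha> where \<alpha>: "\<alpha> \<in> ?K"
    and min: "\<And>\<alpha>'. \<alpha>' \<in> ?K \<Longrightarrow> (\<Sum>i\<in>I. (excess M \<alpha> (P i))\<^sup>2) \<le> (\<Sum>i\<in>I. (excess M \<alpha>' (P i))\<^sup>2)"
    by blast
  note \<alpha>D = additive_betweenD[OF \<alpha>]
  define e where "e i = excess M \<alpha> (P i)" for i
  have disj: "P i \<inter> P j = {}" if "i \<in> I" "j \<in> I" "i \<noteq> j" for i j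
    using P(2) that by (auto simp: disjoint_family_on_def)
  have sub: "P i \<subseteq> space M" if "i \<in> I" for i
    using sets.sets_into_space[OF P(1)[OF that]] .
  have rect: "P i \<times> P j \<in> sets N" if "i \<in> I" "j \<in> I" for i j
    using P(1) that by (auto simp: N_def)
  \<comment> \<open>First-order condition at the minimiser: moving its value on one off-diagonal
    rectangle towards that of any competitor \<beta> cannot decrease the objective to first
    order.\<close>
  have variation: "0 \<le> (\<beta> (P i \<times> P j) - \<alpha> (P i \<times> P j)) * (e i - e j)"
    if ij: "i \<in> I" "j \<in> I" "i \<noteq> j" and \<beta>: "\<beta> \<in> ?K" for i j \<beta>
  proof -
    let ?\<delta> = "\<beta> (P i \<times> P j) - \<alpha> (P i \<times> P j)"
    have "0 \<le> s * (2 * (?\<delta> * (e i - e j))) + s\<^sup>2 * (2 * ?\<delta>\<^sup>2)" if s: "0 \<le> s" "s \<le> 1" for s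
    proof -
      let ?\<alpha>' = "\<lambda>S. if S \<in> sets N
        then \<alpha> S + s * (\<beta> (S \<inter> P i \<times> P j) - \<alpha> (S \<inter> P i \<times> P j)) else 0"
      have K: "?\<alpha>' \<in> ?K"
        by (intro additive_between_perturb \<phi> \<psi> \<alpha> \<beta> rect ij s)
      have "excess M ?\<alpha>' (P k) = e k + (if k = i then s * ?\<delta> else 0) - (if k = j then s * ?\<delta> else 0)"
        if k: "k \<in> I" for k
      proof -
        have "P k \<times> space M \<in> sets N" "space M \<times> P k \<in> sets N"
          using P(1)[OF k] by (auto simp: N_def)
        \<comment> \<open>The strip over block \<open>k\<close> meets the perturbed rectangle only
          for \<open>k = i\<close> (rows) or \<open>k = j\<close> (columns), so no other excess
          changes.\<close>
        moreover have "P k \<times> space M \<inter> P i \<times> P j = (if k = i then P i \<times> P j else {})"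
          "space M \<times> P k \<inter> P i \<times> P j = (if k = j then P i \<times> P j else {})"
          using sub[OF ij(1)] sub[OF ij(2)] disj[OF k ij(1)] disj[OF k ij(2)] by auto
        moreover have "\<alpha> {} = 0" "\<beta> {} = 0"
          using additive_empty[OF additive_betweenD(1)] \<alpha> \<beta> by blast+
        ultimately show ?thesis
          by (simp add: excess_def e_def)
      qed
      then have "(\<Sum>k\<in>I. (excess M ?\<alpha>' (P k))\<^sup>2)
          = (\<Sum>k\<in>I. (e k)\<^sup>2) + 2 * (s * ?\<delta>) * (e i - e j) + 2 * (s * ?\<delta>)\<^sup>2"
        using sum_power2_transfer[OF I ij, of e "s * ?\<delta>"] by simp
      with min[OF K] have "0 \<le> 2 * (s * ?\<delta>) * (e i - e j) + 2 * (s * ?\<delta>)\<^sup>2"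
        unfolding e_def by linarith
      also have "\<dots> = s * (2 * (?\<delta> * (e i - e j))) + s\<^sup>2 * (2 * ?\<delta>\<^sup>2)"
        by (simp only: power2_eq_square distrib_left mult.assoc) (simp add: algebra_simps)
      finally show ?thesis .
    qed
    from nonneg_linear_part[OF this] show ?thesis by linarith
  qed
  \<comment> \<open>Splitting by sign makes \<open>e i > e j\<close> strict for every pair in
    \<open>?I \<times> ?J\<close>, so no ties occur across the cut.\<close>
  let ?I = "{i\<in>I. e i > 0}" and ?J = "{j\<in>I. e j \<le> 0}"
  define X where "X = (\<Union>i\<in>?I. P i)"
  have X: "X \<in> sets M" using I P(1) by (auto simp: X_def)
  have compl: "space M - X = (\<Union>j\<in>?J. P j)"
  proof -
    have "?I \<union> ?J = I" by auto
    then have "space M = X \<union> (\<Union>j\<in>?J. P j)"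
      unfolding X_def cover[symmetric] by blast
    moreover have "X \<inter> (\<Union>j\<in>?J. P j) = {}"
    proof -
      have "P i \<inter> P j = {}" if "i \<in> ?I" "j \<in> ?J" for i j
        using that disj[of i j] by force
      then show ?thesis unfolding X_def by blast
    qed
    ultimately show ?thesis by blast
  qed
  \<comment> \<open>The variation inequality with \<phi> as competitor forces the lower bound on
    outgoing rectangles; with \<psi> it forces the upper bound on incoming ones.\<close>
  have extreme: "\<alpha> (P i \<times> P j) = \<phi> (P i \<times> P j)" "\<alpha> (P j \<times> P i) = \<psi> (P j \<times> P i)"
    if "i \<in> ?I" "j \<in> ?J" for i j
  proof -
    have ij: "i \<in> I" "j \<in> I" "i \<noteq> j" "j \<noteq> i" "e i > e j" using that by auto
    have "0 \<le> \<phi> (P i \<times> P j) - \<alpha> (P i \<times> P j)"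
      using variation[OF ij(1-3) \<phi>K] ij(5) rect[OF ij(1,2)] by (simp add: zero_le_mult_iff)
    then show "\<alpha> (P i \<times> P j) = \<phi> (P i \<times> P j)"
      using \<alpha>D(2)[OF rect[OF ij(1,2)]] by simp
    have "\<psi> (P j \<times> P i) - \<alpha> (P j \<times> P i) \<le> 0"
      using variation[OF ij(2,1,4) \<psi>K] ij(5) rect[OF ij(2,1)] by (simp add: zero_le_mult_iff)
    then show "\<alpha> (P j \<times> P i) = \<psi> (P j \<times> P i)"
      using \<alpha>D(3)[OF rect[OF ij(2,1)]] by simp
  qed
  have rectangles: "\<mu> ((\<Union>i\<in>A. P i) \<times> (\<Union>j\<in>B. P j)) = (\<Sum>(i, j)\<in>A \<times> B. \<mu> (P i \<times> P j))"
    if "additive (sets N) \<mu>" "A \<subseteq> I" "B \<subseteq> I" for \<mu> :: "('a \<times> 'a) set \<Rightarrow> real" and A B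
  proof -
    have "finite A" "finite B" using that I by (auto intro: finite_subset)
    have "\<mu> (\<Union>p\<in>A \<times> B. P (fst p) \<times> P (snd p)) = (\<Sum>p\<in>A \<times> B. \<mu> (P (fst p) \<times> P (snd p)))"
    proof (rule additive_UN[OF that(1)])
      show "disjoint_family_on (\<lambda>p. P (fst p) \<times> P (snd p)) (A \<times> B)"
        unfolding disjoint_family_on_def
      proof (intro ballI impI)
        fix p q assume "p \<in> A \<times> B" "q \<in> A \<times> B" "p \<noteq> q"
        then have "P (fst p) \<inter> P (fst q) = {} \<or> P (snd p) \<inter> P (snd q) = {}"
          using that disj by (metis mem_Times_iff prod_eqI subsetD)
        then show "P (fst p) \<times> P (snd p) \<inter> P (fst q) \<times> P (snd q) = {}"
          by auto
      qed
    qed (use that(2,3) \<open>finite A\<close> \<open>finite B\<close> in \<open>auto intro!: rect\<close>)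
    moreover have "(\<Union>p\<in>A \<times> B. P (fst p) \<times> P (snd p)) = (\<Union>i\<in>A. P i) \<times> (\<Union>j\<in>B. P j)"
      by auto
    ultimately show ?thesis by (simp add: case_prod_beta)
  qed
  have "\<alpha> (X \<times> (space M - X)) = \<phi> (X \<times> (space M - X))"
    unfolding compl unfolding X_def using extreme(1)
    by (subst (1 2) rectangles) (auto simp: \<phi> \<alpha>D intro!: sum.cong)
  moreover have "\<alpha> ((space M - X) \<times> X) = \<psi> ((space M - X) \<times> X)"
    unfolding compl unfolding X_def using extreme(2)
    by (subst (1 2) rectangles) (auto simp: \<psi> \<alpha>D intro!: sum.cong)
  ultimately have "excess M \<alpha> X \<le> 0"
    using excess_cut[OF \<alpha>D(1)[unfolded N_def] X] cut[OF X] by simp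
  moreover have "excess M \<alpha> X = (\<Sum>i\<in>?I. e i)"
    unfolding X_def e_def using P I
    by (intro excess_UN \<alpha>D(1)[unfolded N_def]) (auto simp: disjoint_family_on_def)
  \<comment> \<open>A nonempty finite sum of positive excesses could not be at most 0.\<close>
  ultimately have "?I = {}"
    using sum_pos[of ?I e] I by fastforce
  then have "\<forall>i\<in>I. e i \<le> 0" by force
  \<comment> \<open>The blocks cover \<open>space M\<close>, whose excess is the difference of two
    equal values.\<close>
  moreover have "(\<Sum>i\<in>I. e i) = 0"
    using excess_UN[OF \<alpha>D(1)[unfolded N_def] I P] cover by (simp add: e_def excess_def)
  ultimately have "\<forall>i\<in>I. e i = 0"
    using sum_nonneg_eq_0_iff[of I "\<lambda>i. - e i"] I by (simp add: sum_negf)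
  then show ?thesis
    using \<alpha> by (auto simp: e_def)
qed

section \<open>From finite partitions to all measurable sets\<close>

theorem theorem4p4:
  fixes M :: "'a measure"
    and \<phi> \<psi> :: "('a \<times> 'a) set \<Rightarrow> real"
  assumes "standard_borel M"
    and "finite_signed_measure (M \<Otimes>\<^sub>M M) \<phi>"
    and "finite_signed_measure (M \<Otimes>\<^sub>M M) \<psi>"
  shows "(\<exists>\<alpha>. circulation M \<alpha> \<and>
              signed_measure_le (M \<Otimes>\<^sub>M M) \<phi> \<alpha> \<and> signed_measure_le (M \<Otimes>\<^sub>M M) \<alpha> \<psi>) \<longleftrightarrow>
         signed_measure_le (M \<Otimes>\<^sub>M M) \<phi> \<psi> \<and>
         (\<forall>X\<in>sets M. \<phi> (X \<times> (space M - X)) \<le> \<psi> ((space M - X) \<times> X))"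
    (is "?L \<longleftrightarrow> ?R")
proof
  assume ?L
  then obtain \<alpha> where \<alpha>: "circulation M \<alpha>"
    and le: "\<And>S. S \<in> sets (M \<Otimes>\<^sub>M M) \<Longrightarrow> \<phi> S \<le> \<alpha> S" "\<And>S. S \<in> sets (M \<Otimes>\<^sub>M M) \<Longrightarrow> \<alpha> S \<le> \<psi> S"
    by (auto simp: signed_measure_le_def)
  have "\<phi> (X \<times> (space M - X)) \<le> \<psi> ((space M - X) \<times> X)" if X: "X \<in> sets M" for X
  proof -
    \<comment> \<open>For a circulation the flows across the cut in the two directions agree; one is
      bounded below by \<phi>, the other above by \<psi>.\<close>
    have "excess M \<alpha> X = 0"
      using \<alpha> X by (simp add: circulation_def excess_def)
    then have "\<alpha> (X \<times> (space M - X)) = \<alpha> ((space M - X) \<times> X)"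
      using excess_cut[OF finite_signed_measure_additive X] \<alpha> by (simp add: circulation_def)
    then show ?thesis
      using le(1)[of "X \<times> (space M - X)"] le(2)[of "(space M - X) \<times> X"] X by simp
  qed
  then show ?R
    using le by (auto simp: signed_measure_le_def intro: order_trans)
next
  assume ?R
  then have le: "\<And>S. S \<in> sets (M \<Otimes>\<^sub>M M) \<Longrightarrow> \<phi> S \<le> \<psi> S"
    and cut: "\<And>X. X \<in> sets M \<Longrightarrow> \<phi> (X \<times> (space M - X)) \<le> \<psi> ((space M - X) \<times> X)"
    by (auto simp: signed_measure_le_def)
  let ?K = "additive_between (sets (M \<Otimes>\<^sub>M M)) \<phi> \<psi>"
  note add = assms(2,3)[THEN finite_signed_measure_additive]
  \<comment> \<open>Finite intersection property: each condition involves only two coordinates of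
    \<alpha>, so it is closed, and finitely many at a time suffice.\<close>
  have "?K \<inter> (\<Inter>A\<in>sets M. {\<alpha>. excess M \<alpha> A = 0}) \<noteq> {}"
  proof (rule compact_imp_fip_image[OF compact_additive_between])
    show "closed {\<alpha>. excess M \<alpha> A = 0}" for A
      unfolding excess_def
      by (intro closed_Collect_eq continuous_intros continuous_on_product_coordinates)
  next
    fix F assume F: "finite F" "F \<subseteq> sets M"
    \<comment> \<open>The atoms of the algebra generated by \<open>F\<close>, indexed by the set of
      members of \<open>F\<close> that contain the point. Some atoms may be empty, which does no
      harm.\<close>
    define P where "P i = {x \<in> space M. {A\<in>F. x \<in> A} = i}" for i
    have P: "P i \<in> sets M" if "i \<in> Pow F" for i
    proof -
      have "P i = {x \<in> space M. \<forall>A\<in>F. x \<in> A \<longleftrightarrow> A \<in> i}"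
        using that by (auto simp: P_def)
      also have "\<dots> \<in> sets M"
      proof (rule sets.sets_Collect_finite_All[OF _ F(1)])
        fix A assume "A \<in> F"
        then have "A \<in> sets M" using F(2) by auto
        moreover from this have "{x \<in> space M. x \<in> A \<longleftrightarrow> A \<in> i} = (if A \<in> i then A else space M - A)"
          using sets.sets_into_space by auto
        ultimately show "{x \<in> space M. x \<in> A \<longleftrightarrow> A \<in> i} \<in> sets M" by simp
      qed
      finally show ?thesis .
    qed
    have disj: "disjoint_family_on P I" for I
      by (auto simp: P_def disjoint_family_on_def)
    have own: "x \<in> P {A\<in>F. x \<in> A}" if "x \<in> space M" for x
      using that by (simp add: P_def)
    have "(\<Union>i\<in>Pow F. P i) = space M"
    proof (intro equalityI subsetI)
      fix x assume "x \<in> (\<Union>i\<in>Pow F. P i)"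
      then show "x \<in> space M" unfolding P_def by blast
    next
      fix x assume "x \<in> space M"
      from own[OF this] show "x \<in> (\<Union>i\<in>Pow F. P i)" by (rule UN_I[rotated]) blast
    qed
    then have "\<exists>\<alpha>\<in>?K. \<forall>i\<in>Pow F. excess M \<alpha> (P i) = 0"
      using F(1) by (intro partition_excess_zero[OF add le cut _ P disj]) simp_all
    then obtain \<alpha> where \<alpha>: "\<alpha> \<in> ?K" "\<And>i. i \<subseteq> F \<Longrightarrow> excess M \<alpha> (P i) = 0" by auto
    have "excess M \<alpha> A = 0" if A: "A \<in> F" for A
    proof -
      \<comment> \<open>Each \<open>A\<close> in \<open>F\<close> is the disjoint union of the atoms
        whose index contains it, so its excess is a sum of zeros.\<close>
      have "A = (\<Union>i\<in>{i\<in>Pow F. A \<in> i}. P i)"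
      proof (intro equalityI subsetI)
        fix x assume x: "x \<in> A"
        then have "x \<in> space M"
          using A F(2) sets.sets_into_space[of A M] by blast
        from own[OF this] show "x \<in> (\<Union>i\<in>{i\<in>Pow F. A \<in> i}. P i)"
          by (rule UN_I[rotated]) (use x A in blast)
      next
        fix x assume "x \<in> (\<Union>i\<in>{i\<in>Pow F. A \<in> i}. P i)"
        then show "x \<in> A" unfolding P_def by blast
      qed
      also have "excess M \<alpha> \<dots> = (\<Sum>i\<in>{i\<in>Pow F. A \<in> i}. excess M \<alpha> (P i))"
        using F(1) by (intro excess_UN[OF additive_betweenD(1)[OF \<alpha>(1)] _ P disj]) simp_all
      also have "\<dots> = 0" using \<alpha>(2) by simp
      finally show ?thesis .
    qed
    then show "?K \<inter> (\<Inter>A\<in>F. {\<alpha>. excess M \<alpha> A = 0}) \<noteq> {}"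
      using \<alpha>(1) by blast
  qed
  then obtain \<alpha> where \<alpha>: "\<alpha> \<in> ?K" "\<And>A. A \<in> sets M \<Longrightarrow> excess M \<alpha> A = 0" by auto
  have "circulation M \<alpha>"
    using \<alpha> additive_between_finite_signed_measure[OF assms(2,3) \<alpha>(1)]
    by (simp add: circulation_def excess_def)
  then show ?L
    using additive_betweenD[OF \<alpha>(1)] by (auto simp: signed_measure_le_def)
qed

end
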